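(* Let $A\in\mathbb{R}^{n\times n}$ be an $\tilde{E}_0^s$-matrix with $v(A)>0$, and let $q\in\mathbb{R}^n$. If LCP$(q,A)$ has a unique solution $x^*$, then LCP$(q,A)$ is stable at $x^*$.
   Context: Vector inequalities are componentwise. $\mathrm{SOL}(q,A)=\{z\in\mathbb{R}^n: z\ge 0,\ q+Az\ge 0,\ z^T(q+Az)=0\}$ is the solution set of the linear complementarity problem LCP$(q,A)$. $v(A)$ denotes the value of the two-person zero-sum matrix game with pay-off matrix $A$; $v(A)>0$ if and only if there exists $0\neq x\ge 0$ with $Ax>0$. $A$ is semimonotone ($E_0$) if for every $0\neq x\ge 0$ there is $i$ with $x_i>0$ and $(Ax)_i\ge 0$. $A\in E_0^s$ if $A\in E_0$ and $x\ge 0$, $Ax\ge 0$, $x^TAx=0$ imply $A^Tx\le 0$. $A\in\tilde{E}_0^s$ if $A\in E_0^s$ and for every $x\in \mathrm{SOL}(0,A)$ and every index $i$, $(A^Tx)_i\neq 0$ implies $(Ax)_i\neq 0$. Stability: a solution $x^*$ of LCP$(q,A)$ is stable (LCP$(q,A)$ is stable at $x^*$) if there are neighborhoods $V$ of $x^*$ in $\mathbb{R}^n$ and $U$ of $(q,A)$ in $\mathbb{R}^n\times\mathbb{R}^{n\times n}$ such that (i) $\mathrm{SOL}(\bar q,\bar A)\cap V\neq\emptyset$ for all $(\bar q,\bar A)\in U$; and (ii) $\sup\{\|y-x^*\|: y\in \mathrm{SOL}(\bar q,\bar A)\cap V\}\to 0$ as $(\bar q,\bar A)\to(q,A)$. 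*)

theory Defs
  imports "HOL-Analysis.Analysis"
begin

definition SOL :: "real ^ 'n \<Rightarrow> real ^ 'n ^ 'n \<Rightarrow> (real ^ 'n) set" where
  "SOL q A = {z. 0 \<le> z \<and> 0 \<le> q + A *v z \<and> z \<bullet> (q + A *v z) = 0}"

definition mixed_strategies :: "(real ^ 'n) set" where
  "mixed_strategies = {x. 0 \<le> x \<and> (\<Sum>i\<in>UNIV. x $ i) = 1}"

text \<open>
  The maximizer chooses a mixed strategy on the columns and the minimizer one on the rows.
  This orientation is the one for which the value is positive iff some
  nonzero \<open>x \<ge> 0\<close> satisfies \<open>(A x)\<^sub>i > 0\<close> for all \<open>i\<close>; see \<open>game_value_pos_iff\<close> below.
  Both extrema are over nonempty compact sets and are attained.
\<close>

definition game_value :: "real ^ 'n ^ 'n \<Rightarrow> real" where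
  "game_value A = (SUP x\<in>mixed_strategies. INF y\<in>mixed_strategies. y \<bullet> (A *v x))"

definition semimonotone :: "real ^ 'n ^ 'n \<Rightarrow> bool" where
  "semimonotone A \<longleftrightarrow>
     (\<forall>x. x \<noteq> 0 \<and> 0 \<le> x \<longrightarrow> (\<exists>i. 0 < x $ i \<and> 0 \<le> (A *v x) $ i))"

definition E0s_matrix :: "real ^ 'n ^ 'n \<Rightarrow> bool" where
  "E0s_matrix A \<longleftrightarrow> semimonotone A \<and>
     (\<forall>x. 0 \<le> x \<and> 0 \<le> A *v x \<and> x \<bullet> (A *v x) = 0 \<longrightarrow> transpose A *v x \<le> 0)"

definition E0s_tilde_matrix :: "real ^ 'n ^ 'n \<Rightarrow> bool" where
  "E0s_tilde_matrix A \<longleftrightarrow> E0s_matrix A \<and>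
     (\<forall>x\<in>SOL 0 A. \<forall>i. (transpose A *v x) $ i \<noteq> 0 \<longrightarrow> (A *v x) $ i \<noteq> 0)"

text \<open>
  The supremum is taken in the extended reals, so that it is meaningful even when
  \<open>SOL q' A' \<inter> V\<close> is unbounded. The limit is along the full neighbourhood filter,
  i.e. the point \<open>(q, A)\<close> itself is not excluded; this is equivalent to the punctured limit,
  since a solution \<open>y\<close> for \<open>(q, A)\<close> is also one for every \<open>(q - E y, A + E)\<close>.
\<close>

definition LCP_stable_at :: "real ^ 'n \<Rightarrow> real ^ 'n ^ 'n \<Rightarrow> real ^ 'n \<Rightarrow> bool" where
  "LCP_stable_at q A x \<longleftrightarrow> x \<in> SOL q A \<and>
     (\<exists>V U. open V \<and> x \<in> V \<and> open U \<and> (q, A) \<in> U \<and>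
        (\<forall>(q', A')\<in>U. SOL q' A' \<inter> V \<noteq> {}) \<and>
        ((\<lambda>(q', A'). SUP y\<in>SOL q' A' \<inter> V. ereal (norm (y - x))) \<longlongrightarrow> 0) (nhds (q, A)))"

lemma mixed_strategy_axis: "axis i 1 \<in> mixed_strategies"
  by (auto simp: mixed_strategies_def less_eq_vec_def axis_def)

lemma mixed_strategies_le_1: "x \<in> mixed_strategies \<Longrightarrow> 0 \<le> x $ i \<and> x $ i \<le> 1"
  using member_le_sum[of i UNIV "\<lambda>i. x $ i"]
  by (auto simp: mixed_strategies_def less_eq_vec_def)

lemma compact_mixed_strategies: "compact (mixed_strategies :: (real ^ 'n) set)"
proof -
  have "closed {x :: real ^ 'n. \<forall>i. 0 \<le> x $ i}"
    by (intro closed_Collect_all closed_Collect_le continuous_intros)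
  moreover have "closed {x :: real ^ 'n. (\<Sum>i\<in>UNIV. x $ i) = 1}"
    by (intro closed_Collect_eq continuous_intros)
  ultimately have "closed (mixed_strategies :: (real ^ 'n) set)"
    using closed_Int by (fastforce simp: mixed_strategies_def less_eq_vec_def Collect_conj_eq)
  moreover have "bounded (mixed_strategies :: (real ^ 'n) set)"
  proof (rule boundedI)
    fix x :: "real ^ 'n" assume "x \<in> mixed_strategies"
    then have "(\<Sum>i\<in>UNIV. \<bar>x $ i\<bar>) = 1"
      by (auto simp: mixed_strategies_def less_eq_vec_def)
    then show "norm x \<le> 1" using norm_le_l1_cart[of x] by simp
  qed
  ultimately show ?thesis by (simp add: compact_eq_bounded_closed)
qed

lemma game_value_pos_iff:
  fixes A :: "real ^ 'n ^ 'n"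
  shows "0 < game_value A \<longleftrightarrow> (\<exists>x. x \<noteq> 0 \<and> 0 \<le> x \<and> (\<forall>i. 0 < (A *v x) $ i))"
proof -
  let ?D = "mixed_strategies :: (real ^ 'n) set"
  let ?f = "\<lambda>x. INF y\<in>?D. y \<bullet> (A *v x)"
  have ne: "?D \<noteq> {}" using mixed_strategy_axis by blast
  have bdd: "bdd_below ((\<lambda>y. y \<bullet> w) ` ?D)" for w :: "real ^ 'n"
    by (intro bounded_imp_bdd_below compact_imp_bounded compact_continuous_image
        continuous_intros compact_mixed_strategies)
  have f_le: "?f x \<le> (A *v x) $ i" for x i
    using cINF_lower[OF bdd mixed_strategy_axis[of i], of "A *v x"] by (simp add: inner_axis')
  have "bdd_above (?f ` ?D)"
  proof -
    fix i :: 'n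
    have "compact ((\<lambda>x. (A *v x) $ i) ` ?D)"
      by (intro compact_continuous_image continuous_intros compact_mixed_strategies
          continuous_on_component matrix_vector_mult_linear_continuous_on)
    then have "bdd_above ((\<lambda>x. (A *v x) $ i) ` ?D)"
      by (intro bounded_imp_bdd_above compact_imp_bounded)
    then obtain B where "\<And>x. x \<in> ?D \<Longrightarrow> (A *v x) $ i \<le> B"
      by (auto simp: bdd_above_def)
    then show ?thesis
      by (intro bdd_aboveI2[where M = B] order_trans[OF f_le])
  qed
  then have *: "0 < game_value A \<longleftrightarrow> (\<exists>x\<in>?D. 0 < ?f x)"
    unfolding game_value_def by (rule less_cSUP_iff[OF ne])
  show ?thesis
  proof
    assume "0 < game_value A"
    then obtain x where x: "x \<in> ?D" "0 < ?f x" using * by blast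
    then have "\<forall>i. 0 < (A *v x) $ i" using f_le less_le_trans by blast
    moreover have "x \<noteq> 0" "0 \<le> x" using x(1) by (auto simp: mixed_strategies_def)
    ultimately show "\<exists>x. x \<noteq> 0 \<and> 0 \<le> x \<and> (\<forall>i. 0 < (A *v x) $ i)" by blast
  next
    assume "\<exists>x. x \<noteq> 0 \<and> 0 \<le> x \<and> (\<forall>i. 0 < (A *v x) $ i)"
    then obtain x where x: "x \<noteq> 0" "0 \<le> x" "\<And>i. 0 < (A *v x) $ i" by blast
    define s where "s = (\<Sum>i\<in>UNIV. x $ i)"
    have "s \<noteq> 0"
      using x(1,2) by (auto simp: s_def sum_nonneg_eq_0_iff less_eq_vec_def vec_eq_iff)
    moreover have "0 \<le> s"
      using x(2) by (auto simp: s_def less_eq_vec_def intro: sum_nonneg)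
    ultimately have "0 < s" by simp
    define z where "z = (1 / s) *\<^sub>R x"
    have z: "z \<in> ?D"
      using x(2) \<open>0 < s\<close>
      by (auto simp: z_def mixed_strategies_def less_eq_vec_def s_def sum_divide_distrib[symmetric])
    have pos: "0 < (A *v z) $ i" for i
      using x(3)[of i] \<open>0 < s\<close> by (simp add: z_def matrix_vector_mult_scaleR)
    define m where "m = Min (range (\<lambda>i. (A *v z) $ i))"
    have "0 < m" using pos by (auto simp: m_def)
    have "m \<le> y \<bullet> (A *v z)" if "y \<in> ?D" for y
    proof -
      have "m = (\<Sum>i\<in>UNIV. y $ i * m)"
        using that by (simp add: mixed_strategies_def sum_distrib_right[symmetric])
      also have "\<dots> \<le> (\<Sum>i\<in>UNIV. y $ i * (A *v z) $ i)"
        using mixed_strategies_le_1[OF that]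
        by (intro sum_mono mult_left_mono) (auto simp: m_def)
      finally show ?thesis by (simp add: inner_vec_def)
    qed
    then have "m \<le> ?f z" by (intro cINF_greatest ne)
    then show "0 < game_value A" using * z \<open>0 < m\<close> by force
  qed
qed

end

theory Submission
  imports Defs
begin

text \<open>
  If \<open>A z > 0\<close> with \<open>z \<ge> 0\<close>, then every \<open>u \<in> SOL 0 A\<close> vanishes: otherwise \<open>0 < u\<^sup>T A z\<close>, while
  \<open>A\<^sup>T u \<le> 0\<close>. Together with semimonotonicity, \<open>u = 0\<close> is the only solution of the problem with
  vector \<open>t 1\<close>, for every \<open>t \<ge> 0\<close>. A compactness argument then bounds the solutions for all data
  \<open>(q' + t 1, A')\<close> with \<open>t \<ge> 0\<close> and \<open>(q', A')\<close> near \<open>(q, A)\<close>. As in Karamardian's theorem, Brouwer's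
  theorem on the simplex \<open>y \<ge> 0\<close>, \<open>\<Sum> y \<le> r\<close> gives a solution of such a problem with
  \<open>t = 0\<close> or \<open>\<Sum> y = r\<close>; for large \<open>r\<close> the bound excludes the second case. So nearby problems are
  solvable with uniformly bounded solutions, which must accumulate at the unique solution.
\<close>

section \<open>Limits and scaling of solutions\<close>

lemma tendsto_matrix_vector_mult:
  fixes A :: "'b \<Rightarrow> real ^ 'n ^ 'm"
  assumes "(A \<longlongrightarrow> B) F" "(u \<longlongrightarrow> v) F"
  shows "((\<lambda>k. A k *v u k) \<longlongrightarrow> B *v v) F"
  unfolding matrix_vector_mult_def
  by (intro vec_tendstoI) (auto intro!: tendsto_intros assms)

lemma LIMSEQ_if_dist_less_inverse_Suc:
  assumes "\<And>k. dist (X k) a < inverse (real (Suc k))"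
  shows "X \<longlonglongrightarrow> a"
  using assms by (intro metric_tendsto_imp_tendsto[OF LIMSEQ_inverse_real_of_nat])
    (auto simp: less_imp_le)

text \<open>The sign conditions and complementarity are closed conditions, so they survive joint
  limits of data and solutions. Both compactness arguments below end with this.\<close>

lemma SOL_tendsto:
  fixes A :: "nat \<Rightarrow> real ^ 'n ^ 'n"
  assumes "q \<longlonglongrightarrow> p" "A \<longlonglongrightarrow> B" "z \<longlonglongrightarrow> u" "\<And>k. z k \<in> SOL (q k) (A k)"
  shows "u \<in> SOL p B"
proof -
  have w: "(\<lambda>k. q k + A k *v z k) \<longlonglongrightarrow> p + B *v u"
    by (intro tendsto_intros tendsto_matrix_vector_mult assms)
  have "0 \<le> u $ i" for i
    using assms(4) by (intro LIMSEQ_le_const[OF tendsto_vec_nth[OF assms(3)]])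
      (auto simp: SOL_def less_eq_vec_def)
  moreover have "0 \<le> (p + B *v u) $ i" for i
    using assms(4) by (intro LIMSEQ_le_const[OF tendsto_vec_nth[OF w]])
      (auto simp: SOL_def less_eq_vec_def)
  moreover have "u \<bullet> (p + B *v u) = 0"
  proof (rule LIMSEQ_unique)
    show "(\<lambda>k. z k \<bullet> (q k + A k *v z k)) \<longlonglongrightarrow> u \<bullet> (p + B *v u)"
      by (intro tendsto_inner assms(3) w)
    show "(\<lambda>k. z k \<bullet> (q k + A k *v z k)) \<longlonglongrightarrow> 0"
      using assms(4) by (simp add: SOL_def)
  qed
  ultimately show ?thesis by (simp add: SOL_def less_eq_vec_def)
qed

lemma SOL_scaleR:
  assumes "z \<in> SOL q A" "0 \<le> c"
  shows "c *\<^sub>R z \<in> SOL (c *\<^sub>R q) A"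
proof -
  have *: "c *\<^sub>R q + A *v (c *\<^sub>R z) = c *\<^sub>R (q + A *v z)"
    by (simp add: matrix_vector_mult_scaleR scaleR_add_right)
  show ?thesis using assms
    by (auto simp: SOL_def * less_eq_vec_def simp del: vector_add_component)
qed

section \<open>A bound uniform in the shift t\<close>

lemma mixed_strategies_nonzero: "u \<in> mixed_strategies \<Longrightarrow> u \<noteq> 0"
  by (auto simp: mixed_strategies_def)

lemma SOL_scaled_one_eq_zero:
  fixes A :: "real ^ 'n ^ 'n"
  assumes "E0s_matrix A" "game_value A > 0" "0 \<le> t" "u \<in> SOL (t *\<^sub>R 1) A"
  shows "u = 0"
proof (rule ccontr)
  assume "u \<noteq> 0"
  have u: "0 \<le> u $ i" "0 \<le> t + (A *v u) $ i" for i
    using assms(4) by (auto simp: SOL_def less_eq_vec_def)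
  have "(\<Sum>i\<in>UNIV. u $ i * (t + (A *v u) $ i)) = 0"
    using assms(4) by (auto simp: SOL_def inner_vec_def)
  then have comp: "u $ i * (t + (A *v u) $ i) = 0" for i
    using u by (subst (asm) sum_nonneg_eq_0_iff) auto
  show False
  proof (cases "t = 0")
    case True
    then have "transpose A *v u \<le> 0"
      using assms(1,4) by (auto simp: E0s_matrix_def SOL_def)
    moreover obtain z where z: "0 \<le> z" "\<And>i. 0 < (A *v z) $ i"
      using assms(2) game_value_pos_iff by blast
    ultimately have "z \<bullet> (transpose A *v u) \<le> 0"
      by (auto simp: inner_vec_def less_eq_vec_def intro!: sum_nonpos mult_nonneg_nonpos)
    then have "u \<bullet> (A *v z) \<le> 0"
      by (metis dot_lmul_matrix inner_commute transpose_matrix_vector)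
    moreover obtain j where "u $ j \<noteq> 0"
      using \<open>u \<noteq> 0\<close> by (auto simp: vec_eq_iff)
    then have "0 < u \<bullet> (A *v z)"
      unfolding inner_vec_def using u(1)[of j] u(1) z(2)
      by (intro sum_pos2[of _ j]) (auto simp: less_imp_le order_less_le intro!: mult_pos_pos)
    ultimately show False by simp
  next
    case False
    \<comment> \<open>At this i both factors in \<open>comp\<close> are positive, since t >
      0.\<close>
    obtain i where "0 < u $ i" "0 \<le> (A *v u) $ i"
      using assms(1) \<open>u \<noteq> 0\<close> u(1)
      by (auto simp: E0s_matrix_def semimonotone_def less_eq_vec_def)
    then show False using comp[of i] False assms(3) by simp
  qed
qed

text \<open>Solutions with coordinate sums tending to infinity, for data tending to (q, A), could be
  scaled into the simplex; a limit point there would be a nonzero solution for some vector t 1. The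
  bound covers all t >= 0 because the t delivered by the fixed point argument is not known in
  advance.\<close>

lemma SOL_locally_bounded:
  fixes A :: "real ^ 'n ^ 'n"
  assumes trivial: "\<And>t u. 0 \<le> t \<Longrightarrow> u \<in> SOL (t *\<^sub>R 1) A \<Longrightarrow> u = 0"
  obtains r e where "0 < r" "0 < e"
    "\<And>q' A' t z. dist (q', A') (q, A) < e \<Longrightarrow> 0 \<le> t \<Longrightarrow> z \<in> SOL (q' + t *\<^sub>R 1) A' \<Longrightarrow>
      (\<Sum>i\<in>UNIV. z $ i) < r"
proof -
  have "\<exists>k. \<forall>q' A' t z. dist (q', A') (q, A) < inverse (real (Suc k)) \<longrightarrow> 0 \<le> t \<longrightarrow>
      z \<in> SOL (q' + t *\<^sub>R 1) A' \<longrightarrow> (\<Sum>i\<in>UNIV. z $ i) < real (Suc k)"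
  proof (rule ccontr)
    assume "\<nexists>k. \<forall>q' A' t z. dist (q', A') (q, A) < inverse (real (Suc k)) \<longrightarrow> 0 \<le> t \<longrightarrow>
      z \<in> SOL (q' + t *\<^sub>R 1) A' \<longrightarrow> (\<Sum>i\<in>UNIV. z $ i) < real (Suc k)"
    then have "\<forall>k. \<exists>q' A' t z. dist (q', A') (q, A) < inverse (real (Suc k)) \<and> 0 \<le> t \<and>
      z \<in> SOL (q' + t *\<^sub>R 1) A' \<and> real (Suc k) \<le> (\<Sum>i\<in>UNIV. z $ i)"
      by (meson not_le)
    then obtain Q M T Z where *: "\<And>k. dist (Q k, M k) (q, A) < inverse (real (Suc k))"
      "\<And>k. 0 \<le> T k" "\<And>k. Z k \<in> SOL (Q k + T k *\<^sub>R 1) (M k)"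
      "\<And>k. real (Suc k) \<le> (\<Sum>i\<in>UNIV. Z k $ i)"
      by metis
    \<comment> \<open>Dividing by the coordinate sum puts \<open>U k\<close> on the simplex and
      sends the vector part \<open>p\<close> to 0.\<close>
    define c where "c = (\<lambda>k. inverse (\<Sum>i\<in>UNIV. Z k $ i))"
    define U where "U = (\<lambda>k. c k *\<^sub>R Z k)"
    define s where "s = (\<lambda>k. c k * T k)"
    define p where "p = (\<lambda>k. c k *\<^sub>R Q k)"
    have sum_pos: "0 < (\<Sum>i\<in>UNIV. Z k $ i)" for k
      using *(4)[of k] by simp
    then have c_nonneg: "0 \<le> c k" for k by (simp add: c_def less_imp_le)
    have c_le: "c k \<le> inverse (real (Suc k))" for k
      unfolding c_def by (intro le_imp_inverse_le *(4)) simp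
    have "c \<longlonglongrightarrow> 0"
      by (rule tendsto_sandwich[OF _ _ tendsto_const LIMSEQ_inverse_real_of_nat])
        (use c_nonneg c_le in auto)
    have Q: "Q \<longlonglongrightarrow> q" and M: "M \<longlonglongrightarrow> A"
      using tendsto_fst[OF LIMSEQ_if_dist_less_inverse_Suc[OF *(1)]]
        tendsto_snd[OF LIMSEQ_if_dist_less_inverse_Suc[OF *(1)]] by simp_all
    have p: "p \<longlonglongrightarrow> 0"
      unfolding p_def using tendsto_scaleR[OF \<open>c \<longlonglongrightarrow> 0\<close> Q] by simp
    have U_SOL: "U k \<in> SOL (p k + s k *\<^sub>R 1) (M k)" for k
      using SOL_scaleR[OF *(3) c_nonneg, of k k] by (simp add: U_def p_def s_def scaleR_add_right)
    have U_mixed: "U k \<in> mixed_strategies" for k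
      using *(3)[of k] sum_pos[of k] c_nonneg[of k]
      by (auto simp: U_def mixed_strategies_def SOL_def less_eq_vec_def c_def
          sum_distrib_left[symmetric])
    obtain u f where u: "u \<in> mixed_strategies" and f: "strict_mono (f :: nat \<Rightarrow> nat)"
      and lim: "(U \<circ> f) \<longlonglongrightarrow> u"
      using compact_mixed_strategies U_mixed unfolding compact_def by metis
    have sub: "(\<lambda>k. p (f k)) \<longlonglongrightarrow> 0" "(\<lambda>k. M (f k)) \<longlonglongrightarrow> A" "(\<lambda>k. U (f k)) \<longlonglongrightarrow> u"
      using LIMSEQ_subseq_LIMSEQ[OF p f] LIMSEQ_subseq_LIMSEQ[OF M f] lim by (auto simp: o_def)
    \<comment> \<open>The shifts \<open>T k\<close> may be unbounded. Complementarity and the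
      coordinate sum 1 express \<open>s k\<close> through quantities that converge along
      \<open>f\<close>, so \<open>s\<close> converges along \<open>f\<close> too.\<close>
    have s_eq: "s k = - (U k \<bullet> (p k + M k *v U k))" for k
    proof -
      have "U k \<bullet> 1 = 1"
        using U_mixed[of k] by (simp add: mixed_strategies_def inner_vec_def)
      then show ?thesis
        using U_SOL[of k] by (simp add: SOL_def inner_add_right)
    qed
    define t where "t = - (u \<bullet> (0 + A *v u))"
    have s: "(\<lambda>k. s (f k)) \<longlonglongrightarrow> t"
      unfolding s_eq t_def by (intro tendsto_intros tendsto_matrix_vector_mult sub)
    have "0 \<le> t"
      by (rule LIMSEQ_le_const[OF s]) (use c_nonneg *(2) in \<open>auto simp: s_def\<close>)
    moreover have "u \<in> SOL (0 + t *\<^sub>R 1) A"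
      by (rule SOL_tendsto[OF _ sub(2,3) U_SOL]) (intro tendsto_intros sub(1) s)
    ultimately show False using trivial u mixed_strategies_nonzero by fastforce
  qed
  then obtain k where "\<forall>q' A' t z. dist (q', A') (q, A) < inverse (real (Suc k)) \<longrightarrow> 0 \<le> t \<longrightarrow>
      z \<in> SOL (q' + t *\<^sub>R 1) A' \<longrightarrow> (\<Sum>i\<in>UNIV. z $ i) < real (Suc k)" ..
  then show thesis
    by (intro that[of "real (Suc k)" "inverse (real (Suc k))"]) auto
qed

section \<open>Solvability by Brouwer's theorem\<close>

lemma norm_le_sum_if_nonneg:
  fixes z :: "real ^ 'n"
  assumes "0 \<le> z"
  shows "norm z \<le> (\<Sum>i\<in>UNIV. z $ i)"
  using norm_le_l1_cart[of z] assms by (simp add: less_eq_vec_def)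

text \<open>A fixed point of the projected step y - (q + A y) solves a variational inequality on the
  simplex. Testing it at the vertices yields the optimality conditions, with t as multiplier of the
  sum constraint.\<close>

lemma truncated_LCP_solvable:
  fixes A :: "real ^ 'n ^ 'n"
  assumes "0 < r"
  obtains t z where "0 \<le> t" "z \<in> SOL (q + t *\<^sub>R 1) A" "t = 0 \<or> (\<Sum>i\<in>UNIV. z $ i) = r"
proof -
  define K where "K = {y :: real ^ 'n. (\<forall>i. 0 \<le> y $ i) \<and> (\<Sum>i\<in>UNIV. y $ i) \<le> r}"
  have "closed K"
    unfolding K_def
    by (intro closed_Collect_conj closed_Collect_all closed_Collect_le continuous_intros)
  moreover have "bounded K"
    by (rule boundedI[of _ r])
      (auto simp: K_def less_eq_vec_def intro: order_trans[OF norm_le_sum_if_nonneg])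
  ultimately have "compact K" by (simp add: compact_eq_bounded_closed)
  have "convex K"
    unfolding convex_def
  proof (intro ballI allI impI)
    fix x y :: "real ^ 'n" and a b :: real
    assume H: "x \<in> K" "y \<in> K" "0 \<le> a" "0 \<le> b" "a + b = 1"
    have "a * (\<Sum>i\<in>UNIV. x $ i) + b * (\<Sum>i\<in>UNIV. y $ i) \<le> r"
      using H by (intro convex_bound_le) (auto simp: K_def)
    then show "a *\<^sub>R x + b *\<^sub>R y \<in> K"
      using H by (auto simp: K_def sum.distrib sum_distrib_left)
  qed
  have "0 \<in> K" using assms by (simp add: K_def)
  then have "K \<noteq> {}" by blast
  have axis_K: "axis i r \<in> K" for i
    using assms by (auto simp: K_def axis_def)
  let ?w = "\<lambda>y. q + A *v y"
  obtain z where z: "z \<in> K" "closest_point K (z - ?w z) = z"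
  proof (rule brouwer[OF \<open>compact K\<close> \<open>convex K\<close> \<open>K \<noteq> {}\<close>])
    have "continuous_on K (\<lambda>y. y - ?w y)"
      by (intro continuous_intros matrix_vector_mult_linear_continuous_on)
    then show "continuous_on K (\<lambda>y. closest_point K (y - ?w y))"
      using continuous_on_compose2[OF continuous_on_closest_point[of K UNIV]]
        \<open>convex K\<close> \<open>closed K\<close> \<open>K \<noteq> {}\<close> by blast
    show "(\<lambda>y. closest_point K (y - ?w y)) \<in> K \<rightarrow> K"
      using closest_point_in_set[OF \<open>closed K\<close> \<open>K \<noteq> {}\<close>] by blast
  qed
  \<comment> \<open>The obtuse angle property of the projection, at a point that is its own
    projection.\<close>
  have vi: "?w z \<bullet> z \<le> ?w z \<bullet> y" if "y \<in> K" for y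
    using closest_point_dot[OF \<open>convex K\<close> \<open>closed K\<close> that, of "z - ?w z"] z(2)
    by (simp add: inner_diff_right inner_diff_left inner_add_left)
  txt \<open>The multiplier of the constraint \<open>\<Sum> y \<le> r\<close>.\<close>
  define t where "t = max 0 (Max (range (\<lambda>i. - ?w z $ i)))"
  have t: "0 \<le> t" by (simp add: t_def)
  have dual: "0 \<le> ?w z $ i + t" for i
  proof -
    have "- ?w z $ i \<le> Max (range (\<lambda>i. - ?w z $ i))" by (rule Max_ge) auto
    then have "- ?w z $ i \<le> t" unfolding t_def by (rule max.coboundedI2)
    then show ?thesis by simp
  qed
  \<comment> \<open>The test vertex is 0 if t = 0, and otherwise \<open>axis i r\<close> for an i
    minimizing \<open>?w z $ i\<close>, where that minimum is -t.\<close>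
  have "t * r \<le> - (?w z \<bullet> z)"
  proof (cases "t = 0")
    case True
    then show ?thesis using vi[OF \<open>0 \<in> K\<close>] by simp
  next
    case False
    then have "t = Max (range (\<lambda>i. - ?w z $ i))" unfolding t_def by linarith
    then have "t \<in> range (\<lambda>i. - ?w z $ i)"
      using Max_in[of "range (\<lambda>i. - ?w z $ i)"] by simp
    then obtain i where i: "t = - ?w z $ i" by blast
    have "t * r = - (?w z \<bullet> axis i r)"
      unfolding i by (simp add: inner_axis algebra_simps)
    then show ?thesis using vi[OF axis_K[of i]] by simp
  qed
  moreover have "z \<bullet> (q + t *\<^sub>R 1 + A *v z) = ?w z \<bullet> z + t * (\<Sum>i\<in>UNIV. z $ i)"
    by (simp add: inner_add_right inner_add_left inner_commute[of z] inner_vec_def[of 1])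
  moreover have "t * (\<Sum>i\<in>UNIV. z $ i) \<le> t * r"
    using z(1) t by (intro mult_left_mono) (auto simp: K_def)
  moreover have "0 \<le> z" "0 \<le> q + t *\<^sub>R 1 + A *v z"
    using z(1) dual by (auto simp: K_def less_eq_vec_def algebra_simps)
  moreover from this have "0 \<le> z \<bullet> (q + t *\<^sub>R 1 + A *v z)"
    unfolding inner_vec_def less_eq_vec_def by (intro sum_nonneg) simp
  \<comment> \<open>Here 0 <= z . (q + t 1 + A z) = w . z + t (sum of z) <= w . z + t r <= 0 with w
    = q + A z, so equality holds throughout.\<close>
  ultimately have "z \<in> SOL (q + t *\<^sub>R 1) A \<and> t * (\<Sum>i\<in>UNIV. z $ i) = t * r"
    unfolding SOL_def mem_Collect_eq by linarith
  then show thesis using that t by auto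
qed

section \<open>From local boundedness to stability\<close>

lemma LCP_stable_at_if_locally_bounded:
  fixes A :: "real ^ 'n ^ 'n"
  assumes "SOL q A = {x}" "open U" "(q, A) \<in> U"
    and solvable: "\<And>q' A'. (q', A') \<in> U \<Longrightarrow> SOL q' A' \<noteq> {}"
    and bounded: "\<And>q' A' z. (q', A') \<in> U \<Longrightarrow> z \<in> SOL q' A' \<Longrightarrow> norm z \<le> r"
  shows "LCP_stable_at q A x"
proof -
  \<comment> \<open>Otherwise solutions at distance at least e from x exist for data tending to (q,
    A). They are bounded by r, so a subsequence converges to a solution for (q, A) other than
    x.\<close>
  have close: "\<forall>\<^sub>F (q', A') in nhds (q, A). \<forall>y\<in>SOL q' A'. norm (y - x) < e" if "0 < e" for e
  proof (rule ccontr)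
    let ?P = "\<lambda>(q', A'). \<forall>y\<in>SOL q' A'. norm (y - x) < e"
    assume not_ev: "\<not> eventually ?P (nhds (q, A))"
    have "\<exists>d. d \<in> U \<and> dist d (q, A) < inverse (real (Suc k)) \<and> \<not> ?P d" for k
    proof (rule ccontr)
      assume "\<not> ?thesis"
      then have P: "?P d" if "d \<in> U \<inter> ball (q, A) (inverse (real (Suc k)))" for d
        using that by (auto simp: dist_commute)
      have "open (U \<inter> ball (q, A) (inverse (real (Suc k))))"
        "(q, A) \<in> U \<inter> ball (q, A) (inverse (real (Suc k)))"
        using assms(2,3) by auto
      then show False
        using P not_ev unfolding eventually_nhds by blast
    qed
    then have "\<forall>k. \<exists>q' A' y. (q', A') \<in> U \<and> dist (q', A') (q, A) < inverse (real (Suc k)) \<and>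
        y \<in> SOL q' A' \<and> e \<le> norm (y - x)"
      by (fastforce simp: not_less)
    then obtain Q M Y where *: "\<And>k. (Q k, M k) \<in> U"
      "\<And>k. dist (Q k, M k) (q, A) < inverse (real (Suc k))"
      "\<And>k. Y k \<in> SOL (Q k) (M k)" "\<And>k. e \<le> norm (Y k - x)"
      by metis
    have Q: "Q \<longlonglongrightarrow> q" and M: "M \<longlonglongrightarrow> A"
      using tendsto_fst[OF LIMSEQ_if_dist_less_inverse_Suc[OF *(2)]]
        tendsto_snd[OF LIMSEQ_if_dist_less_inverse_Suc[OF *(2)]] by simp_all
    have "Y k \<in> cball 0 r" for k
      using bounded[OF *(1,3)] by simp
    then obtain y f where f: "strict_mono (f :: nat \<Rightarrow> nat)" and lim: "(Y \<circ> f) \<longlonglongrightarrow> y"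
      using compact_cball[of "0 :: real ^ 'n" r] unfolding compact_def by metis
    have "y \<in> SOL q A"
      by (rule SOL_tendsto[OF LIMSEQ_subseq_LIMSEQ[OF Q f] LIMSEQ_subseq_LIMSEQ[OF M f] lim])
        (simp add: *(3))
    moreover have "e \<le> norm (y - x)"
      by (rule LIMSEQ_le_const[OF tendsto_norm[OF tendsto_diff[OF lim tendsto_const]]])
        (simp add: *(4))
    ultimately show False using \<open>0 < e\<close> assms(1) by simp
  qed
  have "((\<lambda>(q', A'). SUP y\<in>SOL q' A'. ereal (norm (y - x))) \<longlongrightarrow> 0) (nhds (q, A))"
  proof (rule order_tendstoI)
    fix a :: ereal assume "a < 0"
    \<comment> \<open>Solvability matters here: in \<open>ereal\<close> the supremum over an empty
      set is minus infinity.\<close>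
    have "a < (SUP y\<in>SOL q' A'. ereal (norm (y - x)))" if "(q', A') \<in> U" for q' A'
    proof -
      obtain y where "y \<in> SOL q' A'" using solvable[OF \<open>(q', A') \<in> U\<close>] by blast
      then have "ereal (norm (y - x)) \<le> (SUP y\<in>SOL q' A'. ereal (norm (y - x)))"
        by (intro SUP_upper) auto
      then show ?thesis using \<open>a < 0\<close> by (meson less_le_trans ereal_less_eq(5) norm_ge_zero)
    qed
    then show "\<forall>\<^sub>F d in nhds (q, A).
        a < (case d of (q', A') \<Rightarrow> SUP y\<in>SOL q' A'. ereal (norm (y - x)))"
      using eventually_nhds_in_open[OF \<open>open U\<close> \<open>(q, A) \<in> U\<close>]
      by (auto elim!: eventually_mono)
  next
    fix a :: ereal assume "0 < a"
    \<comment> \<open>A real e strictly below a leaves room, since strict bounds on all norms give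
      only a weak bound on the supremum.\<close>
    then obtain e where e: "0 < ereal e" "ereal e < a" using ereal_dense2 by blast
    have "(SUP y\<in>SOL q' A'. ereal (norm (y - x))) < a"
      if "\<forall>y\<in>SOL q' A'. norm (y - x) < e" for q' A'
      using that e(2) by (intro le_less_trans[OF SUP_least e(2)]) (auto simp: less_imp_le)
    then show "\<forall>\<^sub>F d in nhds (q, A).
        (case d of (q', A') \<Rightarrow> SUP y\<in>SOL q' A'. ereal (norm (y - x))) < a"
      using close[of e] e(1) by (auto elim!: eventually_mono)
  qed
  \<comment> \<open>Since r bounds all solutions for data in U, V can be the whole space.\<close>
  then show ?thesis
    unfolding LCP_stable_at_def using assms(1-3) solvable
    by (intro conjI exI[of _ UNIV] exI[of _ U]) auto
qed

theorem theorem28: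
  fixes A :: "real ^ 'n ^ 'n" and q x :: "real ^ 'n"
  assumes "E0s_tilde_matrix A"
    and "game_value A > 0"
    and "SOL q A = {x}"
  shows "LCP_stable_at q A x"
proof -
  have "E0s_matrix A" using assms(1) by (simp add: E0s_tilde_matrix_def)
  then obtain r e where re: "0 < r" "0 < e"
    "\<And>q' A' t z. dist (q', A') (q, A) < e \<Longrightarrow> 0 \<le> t \<Longrightarrow> z \<in> SOL (q' + t *\<^sub>R 1) A' \<Longrightarrow>
      (\<Sum>i\<in>UNIV. z $ i) < r"
    using SOL_locally_bounded[of A q] SOL_scaled_one_eq_zero[OF _ assms(2)] by metis
  show ?thesis
  proof (rule LCP_stable_at_if_locally_bounded[OF assms(3), of "ball (q, A) e"])
    fix q' and A' :: "real ^ 'n ^ 'n"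
    assume near: "(q', A') \<in> ball (q, A) e"
    obtain t z where "0 \<le> t" "z \<in> SOL (q' + t *\<^sub>R 1) A'" "t = 0 \<or> (\<Sum>i\<in>UNIV. z $ i) = r"
      using truncated_LCP_solvable[OF \<open>0 < r\<close>] .
    \<comment> \<open>The strict bound rules out coordinate sum r, which leaves t = 0.\<close>
    with re(3)[of q' A' t z] near have "z \<in> SOL q' A'"
      by (auto simp: dist_commute)
    then show "SOL q' A' \<noteq> {}" by blast
    fix y assume "y \<in> SOL q' A'"
    then show "norm y \<le> r"
      using re(3)[of q' A' 0 y] near norm_le_sum_if_nonneg[of y]
      by (auto simp: dist_commute SOL_def)
  qed (use \<open>0 < e\<close> in auto)
qed

end
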